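(* Let $A\subset\mathbb{R}^n$ be a nonempty, convex and compact set and $B\subset\mathbb{R}^n$ a nonempty, closed and convex set with $A\cap B=\varnothing$. Let $(\gamma_k)_{k\in\mathbb{N}}$, $(\theta_k)_{k\in\mathbb{N}}$, $(\lambda_k)_{k\in\mathbb{N}}$ be summable sequences of nonnegative real numbers, i.e. $\sum_k\gamma_k<\infty$, $\sum_k\theta_k<\infty$, $\sum_k\lambda_k<\infty$, with $0\le\lambda_k<1/2$ for all $k$. For each $k$ let $\varphi_k=\varphi_{\gamma_k,\theta_k,\lambda_k}$ be a relative error tolerance function with forcing parameters $\gamma_k,\theta_k,\lambda_k$. Let $(x^k)_{k\in\mathbb{N}}$ and $(y^k)$ be infinite sequences generated by the ACondG-1 method. Then $(x^k)$ and $(y^k)$ converge, respectively, to points $x^*\in A$ and $y^*\in B$ satisfying $\|x^*-y^*\|=\mathrm{dist}(A,B)$.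
   Context: Notation: $\mathbb{N}=\{0,1,2,\ldots\}$; $\langle\cdot,\cdot\rangle$ is the usual inner product and $\|\cdot\|$ the Euclidean norm on $\mathbb{R}^n$; $P_C$ denotes the (exact) Euclidean projection onto a nonempty closed convex set $C$; $\mathrm{dist}(A,B)=\inf\{\|v-w\|: v\in A,\ w\in B\}$. Relative error tolerance function: for $\gamma,\theta,\lambda\ge 0$, $\varphi_{\gamma,\theta,\lambda}:\mathbb{R}^n\times\mathbb{R}^n\times\mathbb{R}^n\to\mathbb{R}_+$ is any function satisfying $\varphi_{\gamma,\theta,\lambda}(u,v,w)\le\gamma\|v-u\|^2+\theta\|w-v\|^2+\lambda\|w-u\|^2$ for all $u,v,w\in\mathbb{R}^n$. CondG$_C$ procedure (for a compact convex nonempty set $C$, $v\in\mathbb{R}^n$, $u\in C$): start from some $w_0\in C$, $\ell=0$. Step 1: compute $z_\ell\in\arg\min_{z\in C}\langle w_\ell-v,z-w_\ell\rangle$ and $s_\ell^*=\langle w_\ell-v,z_\ell-w_\ell\rangle$. Step 2: if $-s_\ell^*\le\varphi_{\gamma,\theta,\lambda}(u,v,w_\ell)$, stop and output $w^+:=w_\ell$. Step 3: otherwise set $\alpha_\ell=\min\{1,-s_\ell^*/\|z_\ell-w_\ell\|^2\}$, $w_{\ell+1}=w_\ell+\alpha_\ell(z_\ell-w_\ell)$, $\ell\leftarrow\ell+1$, and return to Step 1. The output is written $w^+=\mathrm{CondG}_C(\varphi_{\gamma,\theta,\lambda},u,v)$. (Thus $w^+\in C$ and $\langle v-w^+,z-w^+\rangle\le\varphi_{\gamma,\theta,\lambda}(u,v,w^+)$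 for all $z\in C$.) ACondG-1 method: Step 0: choose $x^0\in A$; if $x^0\in B$ stop; set $k=0$. Step 1: $y^{k+1}:=P_B(x^k)$; if $y^{k+1}\in A$, stop. Step 2: $x^{k+1}:=\mathrm{CondG}_A(\varphi_k,x^k,y^{k+1})$; if $x^{k+1}\in B$, stop. Step 3: $k\leftarrow k+1$ and go to Step 1. It is assumed that each call of CondG$_A$ terminates with an output. *)

theory Defs
  imports "HOL-Analysis.Analysis"
begin

definition rel_error_tol ::
    "real \<Rightarrow> real \<Rightarrow> real \<Rightarrow> ('a::real_inner \<Rightarrow> 'a \<Rightarrow> 'a \<Rightarrow> real) \<Rightarrow> bool" where
  "rel_error_tol \<gamma> \<theta> \<mu> \<phi> \<longleftrightarrow>
     (\<forall>u v w. 0 \<le> \<phi> u v w \<and>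
        \<phi> u v w \<le> \<gamma> * (norm (v - u))\<^sup>2 + \<theta> * (norm (w - v))\<^sup>2 + \<mu> * (norm (w - u))\<^sup>2)"

definition condG_lin_min :: "'a::real_inner set \<Rightarrow> 'a \<Rightarrow> 'a \<Rightarrow> 'a \<Rightarrow> bool" where
  "condG_lin_min C v w z \<longleftrightarrow> is_arg_min (\<lambda>z. (w - v) \<bullet> (z - w)) (\<lambda>z. z \<in> C) z"

text \<open>
  The iterates that a run of the conditional gradient procedure can reach. The starting point and
  the choice of minimizer in each iteration are free, so this is a predicate rather than a
  function. In the rule \<open>step\<close> the stopping test has failed at \<open>w\<close>; for \<open>\<phi> \<ge> 0\<close> this forces
  \<open>z \<noteq> w\<close>, so the quotient in the step size is then a genuine one.
\<close>

inductive condG_iterate ::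
    "'a::real_inner set \<Rightarrow> ('a \<Rightarrow> 'a \<Rightarrow> 'a \<Rightarrow> real) \<Rightarrow> 'a \<Rightarrow> 'a \<Rightarrow> 'a \<Rightarrow> bool"
  for C \<phi> u v where
  start: "w \<in> C \<Longrightarrow> condG_iterate C \<phi> u v w"
| step: "\<lbrakk> condG_iterate C \<phi> u v w; condG_lin_min C v w z;
           \<not> - ((w - v) \<bullet> (z - w)) \<le> \<phi> u v w;
           \<alpha> = min 1 (- ((w - v) \<bullet> (z - w)) / (norm (z - w))\<^sup>2) \<rbrakk>
         \<Longrightarrow> condG_iterate C \<phi> u v (w + \<alpha> *\<^sub>R (z - w))"

text \<open>
  \<open>condG C \<phi> u v w'\<close>: some run of the procedure on \<open>C\<close>, \<open>\<phi>\<close>, \<open>u\<close>, \<open>v\<close> terminates with output \<open>w'\<close>.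
\<close>

definition condG ::
    "'a::real_inner set \<Rightarrow> ('a \<Rightarrow> 'a \<Rightarrow> 'a \<Rightarrow> real) \<Rightarrow> 'a \<Rightarrow> 'a \<Rightarrow> 'a \<Rightarrow> bool" where
  "condG C \<phi> u v w' \<longleftrightarrow> condG_iterate C \<phi> u v w' \<and>
     (\<exists>z. condG_lin_min C v w' z \<and> - ((w' - v) \<bullet> (z - w')) \<le> \<phi> u v w')"

text \<open>
  Infinite sequences generated by the method: none of the stopping tests ever succeeds. The method
  defines \<open>y\<close> from index 1 on only; \<open>y 0\<close> is unconstrained.
\<close>

definition ACondG1_seqs ::
    "'a::euclidean_space set \<Rightarrow> 'a set \<Rightarrow> (nat \<Rightarrow> 'a \<Rightarrow> 'a \<Rightarrow> 'a \<Rightarrow> real) \<Rightarrow>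
     (nat \<Rightarrow> 'a) \<Rightarrow> (nat \<Rightarrow> 'a) \<Rightarrow> bool" where
  "ACondG1_seqs A B \<phi> x y \<longleftrightarrow>
     x 0 \<in> A \<and> x 0 \<notin> B \<and>
     (\<forall>k. y (Suc k) = closest_point B (x k) \<and> y (Suc k) \<notin> A \<and>
          condG A (\<phi> k) (x k) (y (Suc k)) (x (Suc k)) \<and> x (Suc k) \<notin> B)"

end

theory Submission
  imports Defs
begin

text \<open>
  Since \<open>A\<close> is compact, all displacements between iterates are bounded, so the tolerances
  \<open>\<phi>\<^sub>k(x\<^sup>k, y\<^sup>k\<^sup>+\<^sup>1, x\<^sup>k\<^sup>+\<^sup>1)\<close> are dominated by a multiple of \<open>\<gamma>\<^sub>k + \<theta>\<^sub>k + \<mu>\<^sub>k\<close> and hence summable.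
  For every best approximation pair \<open>(a, b)\<close> the projection onto \<open>B\<close> and the inexact projection
  onto \<open>A\<close> give
  \<open>\<parallel>x\<^sup>k\<^sup>+\<^sup>1 - a\<parallel>\<^sup>2 \<le> \<parallel>x\<^sup>k - a\<parallel>\<^sup>2 - \<parallel>(y\<^sup>k\<^sup>+\<^sup>1 - x\<^sup>k) - (b - a)\<parallel>\<^sup>2 + 2\<phi>\<^sub>k(x\<^sup>k, y\<^sup>k\<^sup>+\<^sup>1, x\<^sup>k\<^sup>+\<^sup>1)\<close>.
  Hence the displacements converge to \<open>b - a\<close>, so every limit point of \<open>x\<close> belongs to a best
  approximation pair, and the inequality applied to that pair yields convergence of the whole
  sequence.
\<close>

text \<open>Subtracting the partial sums of \<open>\<epsilon>\<close> from \<open>a\<close> leaves a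
  decreasing sequence bounded below by \<open>- suminf \<epsilon>\<close>.\<close>

lemma quasi_decreasing_convergent:
  fixes a \<epsilon> :: "nat \<Rightarrow> real"
  assumes nonneg: "\<And>k. 0 \<le> a k" and step: "\<And>k. a (Suc k) \<le> a k + \<epsilon> k"
    and eps: "\<And>k. 0 \<le> \<epsilon> k" "summable \<epsilon>"
  shows "convergent a"
proof -
  define b where "b k = a k - (\<Sum>i<k. \<epsilon> i)" for k
  have "decseq b"
    unfolding decseq_Suc_iff b_def using step by (simp add: algebra_simps)
  moreover have "- suminf \<epsilon> \<le> b k" for k
    using sum_le_suminf[OF eps(2), of "{..<k}"] eps(1) nonneg[of k] by (simp add: b_def)
  ultimately obtain L where "b \<longlonglongrightarrow> L"
    using decseq_convergent by blast
  then have "(\<lambda>k. b k + (\<Sum>i<k. \<epsilon> i)) \<longlonglongrightarrow> L + suminf \<epsilon>"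
    by (intro tendsto_add summable_LIMSEQ eps)
  then show ?thesis
    by (auto simp: b_def convergent_def)
qed

lemma quasi_decreasing_gap_tendsto_0:
  fixes a c \<epsilon> :: "nat \<Rightarrow> real"
  assumes "\<And>k. 0 \<le> a k" and c: "\<And>k. 0 \<le> c k"
    and step: "\<And>k. a (Suc k) \<le> a k - c k + \<epsilon> k"
    and eps: "\<And>k. 0 \<le> \<epsilon> k" "summable \<epsilon>"
  shows "c \<longlonglongrightarrow> 0"
proof -
  have "a (Suc k) \<le> a k + \<epsilon> k" for k
    using step[of k] c[of k] by linarith
  with assms obtain L where L: "a \<longlonglongrightarrow> L"
    using quasi_decreasing_convergent[of a \<epsilon>] by (auto simp: convergent_def)
  have "(\<lambda>k. a k - a (Suc k) + \<epsilon> k) \<longlonglongrightarrow> L - L + 0"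
    by (intro tendsto_intros L LIMSEQ_Suc summable_LIMSEQ_zero eps)
  moreover have "c k \<le> a k - a (Suc k) + \<epsilon> k" for k
    using step[of k] by linarith
  ultimately show ?thesis
    using c by (intro tendsto_sandwich[of "\<lambda>_. 0" c]) auto
qed

text \<open>Expand the square of \<open>v - b = (w - a) + ((v - w) - (b - a))\<close>; the
  hypotheses bound the cross terms. Here \<open>w\<close> is an approximate projection of
  \<open>v\<close> with error \<open>e\<close>; \<open>e = 0\<close> covers the exact one.\<close>

lemma inexact_projection_contraction:
  fixes a b v w :: "'a::real_inner"
  assumes "(v - w) \<bullet> (a - w) \<le> e" and "(b - a) \<bullet> (w - a) \<le> 0"
  shows "(norm (w - a))\<^sup>2 \<le> (norm (v - b))\<^sup>2 - (norm ((v - w) - (b - a)))\<^sup>2 + 2 * e"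
proof -
  have "(norm (v - b))\<^sup>2 = (norm (w - a))\<^sup>2 + (norm ((v - w) - (b - a)))\<^sup>2
      - 2 * ((v - w) \<bullet> (a - w)) - 2 * ((b - a) \<bullet> (w - a))"
    by (simp add: power2_norm_eq_inner inner_diff inner_commute)
  with assms show ?thesis by linarith
qed

text \<open>Otherwise a short move from \<open>a\<close> towards \<open>w\<close> would stay in
  \<open>A\<close> by convexity and come closer to \<open>b\<close> than
  \<open>setdist A B\<close>.\<close>

lemma setdist_pair_dot:
  fixes A B :: "'a::euclidean_space set"
  assumes "convex A" "a \<in> A" "b \<in> B" "norm (a - b) = setdist A B" "w \<in> A"
  shows "(b - a) \<bullet> (w - a) \<le> 0"
proof (rule ccontr)
  assume "\<not> (b - a) \<bullet> (w - a) \<le> 0"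
  then obtain u where u: "0 < u" "u \<le> 1" "dist (a + u *\<^sub>R (w - a)) b < dist a b"
    using closer_point_lemma[of b a w] by (auto simp: dist_commute)
  have "a + u *\<^sub>R (w - a) = (1 - u) *\<^sub>R a + u *\<^sub>R w"
    by (simp add: algebra_simps)
  then have "a + u *\<^sub>R (w - a) \<in> A"
    using convexD[OF assms(1,2,5), of "1 - u" u] u by simp
  then have "setdist A B \<le> dist (a + u *\<^sub>R (w - a)) b"
    using assms(3) by (rule setdist_le_dist)
  with u assms(4) show False by (simp add: dist_norm)
qed

lemma condG_iterate_mem:
  assumes "condG_iterate C \<phi> u v w" and "convex C" and "\<And>w. 0 \<le> \<phi> u v w"
  shows "w \<in> C"
  using assms(1)
proof induction
  case (start w)
  then show ?case .
next
  case (step w z \<alpha>)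
  \<comment> \<open>The failed stopping test makes this quantity exceed \<open>\<phi> u v w\<close>,
    so the step size lies in [0, 1] and the new iterate is a convex combination of \<open>w\<close>
    and \<open>z\<close>.\<close>
  have "0 \<le> - ((w - v) \<bullet> (z - w))"
    using step assms(3)[of w] by linarith
  then have "0 \<le> - ((w - v) \<bullet> (z - w)) / (norm (z - w))\<^sup>2"
    by (intro divide_nonneg_nonneg) auto
  then have "0 \<le> \<alpha>" "\<alpha> \<le> 1"
    unfolding step(4) by (simp_all only: min.cobounded1 min.bounded_iff zero_le_one)
  moreover have "z \<in> C"
    using step by (simp add: condG_lin_min_def is_arg_min_def)
  moreover have "w + \<alpha> *\<^sub>R (z - w) = (1 - \<alpha>) *\<^sub>R w + \<alpha> *\<^sub>R z"
    by (simp add: algebra_simps)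
  ultimately show ?case
    using step convexD[OF \<open>convex C\<close>, of w z "1 - \<alpha>" \<alpha>] by simp
qed

text \<open>The stopping test bounds only the value at the computed minimizer; minimality carries
  the bound over to every \<open>z\<close> in \<open>C\<close>.\<close>

lemma condG_dot_le:
  assumes "condG C \<phi> u v w" and "z \<in> C"
  shows "(v - w) \<bullet> (z - w) \<le> \<phi> u v w"
proof -
  obtain z' where z': "condG_lin_min C v w z'" "- ((w - v) \<bullet> (z' - w)) \<le> \<phi> u v w"
    using assms(1) by (auto simp: condG_def)
  then have "(w - v) \<bullet> (z' - w) \<le> (w - v) \<bullet> (z - w)"
    using assms(2) by (auto simp: condG_lin_min_def is_arg_min_linorder)
  moreover have "(v - w) \<bullet> (z - w) = - ((w - v) \<bullet> (z - w))"
    by (simp flip: inner_minus_left)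
  ultimately show ?thesis
    using z'(2) by linarith
qed

theorem theorem9:
  fixes A B :: "(real ^ 'n) set"
    and \<gamma> \<theta> \<mu> :: "nat \<Rightarrow> real"
    and \<phi> :: "nat \<Rightarrow> real ^ 'n \<Rightarrow> real ^ 'n \<Rightarrow> real ^ 'n \<Rightarrow> real"
    and x y :: "nat \<Rightarrow> real ^ 'n"
  assumes "A \<noteq> {}" and "convex A" and "compact A"
    and "B \<noteq> {}" and "closed B" and "convex B"
    and "A \<inter> B = {}"
    and "\<And>k. 0 \<le> \<gamma> k" and "\<And>k. 0 \<le> \<theta> k" and "\<And>k. 0 \<le> \<mu> k" and "\<And>k. \<mu> k < 1 / 2"
    and "summable \<gamma>" and "summable \<theta>" and "summable \<mu>"
    and "\<And>k. rel_error_tol (\<gamma> k) (\<theta> k) (\<mu> k) (\<phi> k)"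
    and "ACondG1_seqs A B \<phi> x y"
  shows "\<exists>xs\<in>A. \<exists>ys\<in>B. x \<longlonglongrightarrow> xs \<and> y \<longlonglongrightarrow> ys \<and> norm (xs - ys) = setdist A B"
proof -
  note A = assms(1-3) and B = assms(4-6)
  have x0: "x 0 \<in> A" and y_eq: "\<And>k. y (Suc k) = closest_point B (x k)"
    and cg: "\<And>k. condG A (\<phi> k) (x k) (y (Suc k)) (x (Suc k))"
    using assms(16) unfolding ACondG1_seqs_def by blast+
  have \<phi>_nonneg: "0 \<le> \<phi> k u v w" for k u v w
    using assms(15) by (auto simp: rel_error_tol_def)
  have x_A: "x k \<in> A" for k
  proof (cases k)
    case (Suc i)
    have "condG_iterate A (\<phi> i) (x i) (y (Suc i)) (x (Suc i))"
      using cg by (simp add: condG_def)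
    then show ?thesis
      unfolding Suc by (rule condG_iterate_mem[OF _ A(2) \<phi>_nonneg])
  qed (simp add: x0)
  have P_cont: "continuous_on S (closest_point B)" for S
    using continuous_on_closest_point B by blast

  \<comment> \<open>A bounded set holding every \<open>x k\<close> and \<open>y (Suc k)\<close>,
    although \<open>B\<close> itself may be unbounded.\<close>
  define K where "K = A \<union> closest_point B ` A"
  define M where "M = (diameter K)\<^sup>2"
  define \<epsilon> where "\<epsilon> k = 2 * \<phi> k (x k) (y (Suc k)) (x (Suc k))" for k
  have "bounded K"
    unfolding K_def using A(3) P_cont
    by (intro compact_imp_bounded compact_Un compact_continuous_image)
  then have "norm (p - q) \<le> diameter K" if "p \<in> K" "q \<in> K" for p q
    using diameter_bounded_bound that by (metis dist_norm)
  then have M: "(norm (p - q))\<^sup>2 \<le> M" if "p \<in> K" "q \<in> K" for p q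
    unfolding M_def using that by (intro power_mono) auto
  have xy_K: "x k \<in> K" "y (Suc k) \<in> K" for k
    using x_A by (auto simp: K_def y_eq)
  have \<epsilon>_nonneg: "0 \<le> \<epsilon> k" for k
    by (simp add: \<epsilon>_def \<phi>_nonneg)
  have \<epsilon>_le: "\<epsilon> k \<le> 2 * (\<gamma> k * M + \<theta> k * M + \<mu> k * M)" for k
  proof -
    have "\<phi> k (x k) (y (Suc k)) (x (Suc k)) \<le> \<gamma> k * (norm (y (Suc k) - x k))\<^sup>2
        + \<theta> k * (norm (x (Suc k) - y (Suc k)))\<^sup>2 + \<mu> k * (norm (x (Suc k) - x k))\<^sup>2"
      using assms(15) by (auto simp: rel_error_tol_def)
    also have "\<dots> \<le> \<gamma> k * M + \<theta> k * M + \<mu> k * M"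
      by (intro add_mono mult_left_mono M xy_K assms)
    finally show ?thesis
      by (simp add: \<epsilon>_def)
  qed
  have \<epsilon>_summable: "summable \<epsilon>"
  proof (rule summable_comparison_test')
    show "summable (\<lambda>k. 2 * (\<gamma> k * M + \<theta> k * M + \<mu> k * M))"
      by (intro summable_mult summable_add summable_mult2 assms)
    show "norm (\<epsilon> k) \<le> 2 * (\<gamma> k * M + \<theta> k * M + \<mu> k * M)" if "k \<ge> 0" for k
      using \<epsilon>_le \<epsilon>_nonneg by simp
  qed

  \<comment> \<open>Stated for an arbitrary best pair, since it is used first for an auxiliary pair
    and later for the limit pair.\<close>
  have fejer: "(norm (x (Suc k) - a))\<^sup>2
      \<le> (norm (x k - a))\<^sup>2 - (norm ((x k - y (Suc k)) - (a - b)))\<^sup>2 + \<epsilon> k"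
    if ab: "a \<in> A" "b \<in> B" "norm (a - b) = setdist A B" for a b k
  proof -
    let ?v = "y (Suc k)" and ?w = "x (Suc k)"
    have vB: "?v \<in> B"
      by (simp add: y_eq closest_point_in_set B)
    have "(?v - ?w) \<bullet> (a - ?w) \<le> \<phi> k (x k) ?v ?w"
      using condG_dot_le[OF cg ab(1)] .
    moreover have "(b - a) \<bullet> (?w - a) \<le> 0"
      using setdist_pair_dot A ab x_A by blast
    ultimately have "(norm (?w - a))\<^sup>2 \<le> (norm (?v - b))\<^sup>2
        - (norm ((?v - ?w) - (b - a)))\<^sup>2 + \<epsilon> k"
      unfolding \<epsilon>_def by (rule inexact_projection_contraction)
    \<comment> \<open>The exact half-step onto \<open>B\<close>, with \<open>a\<close> and
      \<open>b\<close> exchanged. Its gap term is kept; that of the half-step onto \<open>A\<close>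
      is dropped.\<close>
    moreover have "(norm (?v - b))\<^sup>2 \<le> (norm (x k - a))\<^sup>2
        - (norm ((x k - ?v) - (a - b)))\<^sup>2 + 2 * 0"
    proof (rule inexact_projection_contraction)
      show "(x k - ?v) \<bullet> (b - ?v) \<le> 0"
        unfolding y_eq using closest_point_dot B ab(2) by blast
      show "(a - b) \<bullet> (?v - b) \<le> 0"
        using setdist_pair_dot[OF B(3) ab(2,1) _ vB] ab(3)
        by (simp add: norm_minus_commute setdist_sym)
    qed
    moreover have "0 \<le> (norm ((?v - ?w) - (b - a)))\<^sup>2"
      by simp
    ultimately show ?thesis
      by linarith
  qed

  obtain a b where ab: "a \<in> A" "b \<in> B" "norm (a - b) = setdist A B"
    using setdist_compact_closed[of A B] A B by (auto simp: dist_norm)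
  have "(\<lambda>k. (norm ((x k - y (Suc k)) - (a - b)))\<^sup>2) \<longlonglongrightarrow> 0"
    by (rule quasi_decreasing_gap_tendsto_0[OF _ _ fejer[OF ab] \<epsilon>_nonneg \<epsilon>_summable]) auto
  then have gap: "(\<lambda>k. x k - y (Suc k)) \<longlonglongrightarrow> a - b"
    by (simp add: tendsto_norm_zero_iff LIM_zero_iff flip: tendsto_null_power)

  obtain xs r where xs: "xs \<in> A" and r: "strict_mono r" "(x \<circ> r) \<longlonglongrightarrow> xs"
    using A(3) x_A unfolding compact_def by blast
  define ys where "ys = closest_point B xs"
  have P_lim: "(\<lambda>k. closest_point B (f k)) \<longlonglongrightarrow> ys" if "f \<longlonglongrightarrow> xs" for f :: "nat \<Rightarrow> real ^ 'n"
    unfolding ys_def using continuous_on_tendsto_compose[OF P_cont[of UNIV] that] by simp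
  \<comment> \<open>Two computations of one limit, by continuity of the projection and by
    \<open>gap\<close>, show that \<open>xs\<close> and \<open>ys\<close> form a best pair.\<close>
  have "(\<lambda>k. x (r k) - y (Suc (r k))) \<longlonglongrightarrow> xs - ys"
    using tendsto_diff[OF r(2) P_lim[OF r(2)]] by (simp add: y_eq)
  moreover have "(\<lambda>k. x (r k) - y (Suc (r k))) \<longlonglongrightarrow> a - b"
    using LIMSEQ_subseq_LIMSEQ[OF gap r(1)] by (simp add: comp_def)
  ultimately have "xs - ys = a - b"
    by (rule LIMSEQ_unique)
  then have dist_eq: "norm (xs - ys) = setdist A B"
    using ab(3) by simp
  have ys: "ys \<in> B"
    by (simp add: ys_def closest_point_in_set B)

  let ?d = "\<lambda>k. (norm (x k - xs))\<^sup>2"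
  have "?d (Suc k) \<le> ?d k + \<epsilon> k" for k
    using fejer[OF xs ys dist_eq, of k] by (smt (verit) zero_le_power2)
  then obtain L where L: "?d \<longlonglongrightarrow> L"
    using quasi_decreasing_convergent[of ?d \<epsilon>] \<epsilon>_nonneg \<epsilon>_summable
    by (auto simp: convergent_def)
  \<comment> \<open>The whole sequence of squared distances converges, so the subsequence determines
    its limit.\<close>
  have "(\<lambda>k. (norm ((x \<circ> r) k - xs))\<^sup>2) \<longlonglongrightarrow> (norm (xs - xs))\<^sup>2"
    by (intro tendsto_intros r)
  then have "L = 0"
    using LIMSEQ_unique[OF LIMSEQ_subseq_LIMSEQ[OF L r(1)]] by (simp add: comp_def)
  with L have x_lim: "x \<longlonglongrightarrow> xs"
    by (simp add: tendsto_norm_zero_iff LIM_zero_iff flip: tendsto_null_power)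
  \<comment> \<open>The shift by one is needed because \<open>y_eq\<close> describes
    \<open>y\<close> from index 1 on.\<close>
  have "y \<longlonglongrightarrow> ys"
    using P_lim[OF x_lim] by (subst filterlim_sequentially_Suc[symmetric]) (simp add: y_eq)
  with xs ys x_lim dist_eq show ?thesis
    by blast
qed

end
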